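(* Consider the buffer management problem with exactly two packet values $1$ and $\alpha>1$, with exactly one queue for each value and both queues of the same capacity $B$. Then the online algorithm GREEDY is $\frac{\alpha+2}{\alpha+1}$-competitive, i.e., for every input sequence $\sigma$, $\mathrm{OPT}(\sigma)\le \frac{\alpha+2}{\alpha+1}\,\mathrm{GREEDY}(\sigma)$.
   Context: Model: packets of value $1$ or $\alpha$ arrive over time (at non-integral times), chosen by an adversary; each goes to the queue of its value, which holds at most $B$ packets, and is either admitted (only if there is room) or rejected. At the end of each unit time step (send event) at most one packet from a non-empty queue is transmitted. Benefit is the total value of transmitted packets. $\mathrm{OPT}(\sigma)$ is the maximum benefit achievable by an offline algorithm knowing $\sigma$ in advance. GREEDY accepts every packet whose queue is not full, and at each send event sends an $\alpha$-packet if its $\alpha$-queue is non-empty, otherwise a $1$-packet if available. *)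

theory Defs
  imports Complex_Main
begin

datatype kind = Low | High

fun pval :: "real \<Rightarrow> kind \<Rightarrow> real" where
  "pval \<alpha> Low = 1"
| "pval \<alpha> High = \<alpha>"

text \<open>A packet is given by its arrival time and its kind. The \<open>t\<close>-th time step is the open
  interval from \<open>t\<close> to \<open>t + 1\<close>, followed by the send event at time \<open>t + 1\<close>.\<close>

type_synonym packet = "real \<times> kind"

definition input_sequence :: "packet list \<Rightarrow> bool" where
  "input_sequence \<sigma> \<longleftrightarrow>
     sorted (map fst \<sigma>) \<and> (\<forall>p\<in>set \<sigma>. 0 < fst p \<and> fst p \<notin> \<int>)"

definition slot :: "packet list \<Rightarrow> nat \<Rightarrow> kind list" where
  "slot \<sigma> t = map snd (filter (\<lambda>p. real t < fst p \<and> fst p < real (Suc t)) \<sigma>)"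

text \<open>Packets in one queue all have the same value, so a buffer is described by the
  lengths of its two queues.\<close>

type_synonym queues = "kind \<Rightarrow> nat"

text \<open>\<open>admission B q ks q'\<close>: starting from \<open>q\<close>, deciding on the arriving packets \<open>ks\<close> one
  after the other may lead to \<open>q'\<close>. A packet may be rejected even if there is room for it.\<close>

inductive admission :: "nat \<Rightarrow> queues \<Rightarrow> kind list \<Rightarrow> queues \<Rightarrow> bool" for B where
  none: "admission B q [] q"
| reject: "admission B q ks q' \<Longrightarrow> admission B q (k # ks) q'"
| admit: "q k < B \<Longrightarrow> admission B (q(k := q k + 1)) ks q' \<Longrightarrow> admission B q (k # ks) q'"

inductive transmission :: "queues \<Rightarrow> kind option \<Rightarrow> queues \<Rightarrow> bool" where
  idle: "transmission q None q"
| send: "q k > 0 \<Longrightarrow> transmission q (Some k) (q(k := q k - 1))"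

text \<open>\<open>s t\<close> is the kind of the packet transmitted at the \<open>t\<close>-th send event, if any. Since an
  offline algorithm knows \<open>\<sigma>\<close>, it may realise every sequence of legal decisions. Send events
  go on forever, so packets still stored after the last arrival can be transmitted.\<close>

definition feasible :: "nat \<Rightarrow> packet list \<Rightarrow> (nat \<Rightarrow> kind option) \<Rightarrow> bool" where
  "feasible B \<sigma> s \<longleftrightarrow>
     (\<exists>q q'. q 0 = (\<lambda>_. 0) \<and>
       (\<forall>t. admission B (q t) (slot \<sigma> t) (q' t) \<and> transmission (q' t) (s t) (q (Suc t))))"

definition benefit :: "real \<Rightarrow> (nat \<Rightarrow> kind option) \<Rightarrow> real" where
  "benefit \<alpha> s = (\<Sum>t. case s t of None \<Rightarrow> 0 | Some k \<Rightarrow> pval \<alpha> k)"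

definition OPT :: "real \<Rightarrow> nat \<Rightarrow> packet list \<Rightarrow> real" where
  "OPT \<alpha> B \<sigma> = Max {benefit \<alpha> s | s. feasible B \<sigma> s}"

fun greedy_admit :: "nat \<Rightarrow> queues \<Rightarrow> kind list \<Rightarrow> queues" where
  "greedy_admit B q [] = q"
| "greedy_admit B q (k # ks) = greedy_admit B (if q k < B then q(k := q k + 1) else q) ks"

definition greedy_choice :: "queues \<Rightarrow> kind option" where
  "greedy_choice q = (if q High > 0 then Some High else if q Low > 0 then Some Low else None)"

definition remove :: "kind option \<Rightarrow> queues \<Rightarrow> queues" where
  "remove c q = (case c of None \<Rightarrow> q | Some k \<Rightarrow> q(k := q k - 1))"

text \<open>Queue lengths of GREEDY at the beginning of the \<open>t\<close>-th time step, and the kind of the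
  packet it transmits at the end of that step.\<close>

primrec greedy_queues :: "nat \<Rightarrow> packet list \<Rightarrow> nat \<Rightarrow> queues" where
  "greedy_queues B \<sigma> 0 = (\<lambda>_. 0)"
| "greedy_queues B \<sigma> (Suc t) =
     (let q = greedy_admit B (greedy_queues B \<sigma> t) (slot \<sigma> t) in remove (greedy_choice q) q)"

definition greedy_schedule :: "nat \<Rightarrow> packet list \<Rightarrow> nat \<Rightarrow> kind option" where
  "greedy_schedule B \<sigma> t =
     greedy_choice (greedy_admit B (greedy_queues B \<sigma> t) (slot \<sigma> t))"

definition GREEDY :: "real \<Rightarrow> nat \<Rightarrow> packet list \<Rightarrow> real" where
  "GREEDY \<alpha> B \<sigma> = benefit \<alpha> (greedy_schedule B \<sigma>)"

text \<open>Well-definedness: the sum in \<open>benefit\<close> has only finitely many nonzero terms for feasible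
  schedules, the maximum in \<open>OPT\<close> is taken over a finite nonempty set, and GREEDY is one of
  the competing schedules.\<close>

lemma admission_total:
  "admission B q ks q' \<Longrightarrow> q' Low + q' High \<le> q Low + q High + length ks"
proof (induction rule: admission.induct)
  case (admit q k ks q')
  then show ?case by (cases k) auto
qed auto

lemma transmission_total:
  "transmission q c q' \<Longrightarrow> q' Low + q' High + (if c = None then 0 else 1) = q Low + q High"
proof (induction rule: transmission.induct)
  case (send q k)
  then show ?case by (cases k) auto
qed auto

lemma slots_total:
  "(\<Sum>u<t. length (slot \<sigma> u)) \<le> length (filter (\<lambda>p. fst p < real t) \<sigma>)"
proof (induction t)
  case (Suc t)
  have "length (filter (\<lambda>p. fst p < real t) \<sigma>) + length (slot \<sigma> t)
      \<le> length (filter (\<lambda>p. fst p < real (Suc t)) \<sigma>)"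
    unfolding slot_def by (induction \<sigma>) auto
  with Suc show ?case by simp
qed simp

lemma sent_le:
  assumes "feasible B \<sigma> s"
  shows "card {u. u < t \<and> s u \<noteq> None} \<le> length \<sigma>"
proof -
  from assms obtain q q' where q0: "q 0 = (\<lambda>_. 0)"
    and adm: "\<And>t. admission B (q t) (slot \<sigma> t) (q' t)"
    and tra: "\<And>t. transmission (q' t) (s t) (q (Suc t))"
    unfolding feasible_def by blast
  have "q t Low + q t High + card {u. u < t \<and> s u \<noteq> None} \<le> (\<Sum>u<t. length (slot \<sigma> u))"
  proof (induction t)
    case (Suc t)
    have "{u. u < Suc t \<and> s u \<noteq> None} =
        (if s t = None then {u. u < t \<and> s u \<noteq> None} else insert t {u. u < t \<and> s u \<noteq> None})"
      by (auto simp: less_Suc_eq)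
    then have "card {u. u < Suc t \<and> s u \<noteq> None} =
        card {u. u < t \<and> s u \<noteq> None} + (if s t = None then 0 else 1)"
      by simp
    with Suc admission_total[OF adm[of t]] transmission_total[OF tra[of t]]
    show ?case by (simp split: if_splits)
  qed (simp add: q0)
  also have "\<dots> \<le> length \<sigma>"
    using slots_total[of \<sigma> t] length_filter_le order.trans by blast
  finally show ?thesis by simp
qed

lemma finite_sent:
  assumes "feasible B \<sigma> s"
  shows "finite {t. s t \<noteq> None}" "card {t. s t \<noteq> None} \<le> length \<sigma>"
proof -
  have *: "card F \<le> length \<sigma>" if F: "F \<subseteq> {t. s t \<noteq> None}" "finite F" for F
  proof -
    from \<open>finite F\<close> obtain n where "\<forall>t\<in>F. t < n"
      using finite_nat_set_iff_bounded by blast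
    with F have "F \<subseteq> {u. u < n \<and> s u \<noteq> None}" by auto
    then have "card F \<le> card {u. u < n \<and> s u \<noteq> None}" by (intro card_mono) auto
    with sent_le[OF assms, of n] show ?thesis by simp
  qed
  show fin: "finite {t. s t \<noteq> None}"
  proof (rule ccontr)
    assume "infinite {t. s t \<noteq> None}"
    then obtain F where "finite F" "card F = Suc (length \<sigma>)" "F \<subseteq> {t. s t \<noteq> None}"
      using infinite_arbitrarily_large by metis
    with *[of F] show False by simp
  qed
  from *[OF _ this] show "card {t. s t \<noteq> None} \<le> length \<sigma>" by simp
qed

lemma benefit_eq:
  assumes "feasible B \<sigma> s"
  shows "benefit \<alpha> s = real (card {t. s t = Some Low}) + \<alpha> * real (card {t. s t = Some High})"
proof -
  have S: "{t. s t \<noteq> None} = {t. s t = Some Low} \<union> {t. s t = Some High}"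
  proof (intro equalityI subsetI)
    fix t assume "t \<in> {t. s t \<noteq> None}"
    then obtain k where "s t = Some k" by auto
    then show "t \<in> {t. s t = Some Low} \<union> {t. s t = Some High}" by (cases k) auto
  qed auto
  with finite_sent(1)[OF assms]
  have fin: "finite {t. s t = Some Low}" "finite {t. s t = Some High}" by auto
  have "benefit \<alpha> s = (\<Sum>t | s t \<noteq> None. case s t of None \<Rightarrow> 0 | Some k \<Rightarrow> pval \<alpha> k)"
    unfolding benefit_def by (rule suminf_finite[OF finite_sent(1)[OF assms]]) auto
  also have "\<dots> = (\<Sum>t | s t = Some Low. case s t of None \<Rightarrow> 0 | Some k \<Rightarrow> pval \<alpha> k)
      + (\<Sum>t | s t = Some High. case s t of None \<Rightarrow> 0 | Some k \<Rightarrow> pval \<alpha> k)"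
    unfolding S by (rule sum.union_disjoint[OF fin]) auto
  finally show ?thesis by simp
qed

lemma finite_benefits: "finite {benefit \<alpha> s | s. feasible B \<sigma> s}"
proof (rule finite_subset)
  show "{benefit \<alpha> s | s. feasible B \<sigma> s} \<subseteq>
      (\<lambda>(a, b). real a + \<alpha> * real b) ` ({..length \<sigma>} \<times> {..length \<sigma>})"
  proof clarify
    fix s assume s: "feasible B \<sigma> s"
    have "card {t. s t = Some k} \<le> length \<sigma>" for k
    proof -
      have "card {t. s t = Some k} \<le> card {t. s t \<noteq> None}"
        by (rule card_mono[OF finite_sent(1)[OF s]]) auto
      with finite_sent(2)[OF s] show ?thesis by (rule order.trans[rotated])
    qed
    with benefit_eq[OF s, of \<alpha>]
    show "benefit \<alpha> s \<in> (\<lambda>(a, b). real a + \<alpha> * real b) ` ({..length \<sigma>} \<times> {..length \<sigma>})"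
      by (auto intro!: image_eqI[where x = "(card {t. s t = Some Low}, card {t. s t = Some High})"])
  qed
qed simp

lemma greedy_admission: "admission B q ks (greedy_admit B q ks)"
  by (induction ks arbitrary: q) (auto intro: admission.intros)

lemma greedy_transmission: "transmission q (greedy_choice q) (remove (greedy_choice q) q)"
  unfolding greedy_choice_def remove_def
  using send[of q High] send[of q Low] by (simp add: idle)

lemma greedy_feasible: "feasible B \<sigma> (greedy_schedule B \<sigma>)"
  unfolding feasible_def greedy_schedule_def
  by (rule exI[of _ "greedy_queues B \<sigma>"],
      rule exI[of _ "\<lambda>t. greedy_admit B (greedy_queues B \<sigma> t) (slot \<sigma> t)"])
     (simp add: Let_def greedy_admission greedy_transmission)

lemma OPT_attained: "\<exists>s. feasible B \<sigma> s \<and> OPT \<alpha> B \<sigma> = benefit \<alpha> s"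
  using Max_in[OF finite_benefits[of \<alpha> B \<sigma>]] greedy_feasible unfolding OPT_def by blast

lemma benefit_le_OPT: "feasible B \<sigma> s \<Longrightarrow> benefit \<alpha> s \<le> OPT \<alpha> B \<sigma>"
  unfolding OPT_def by (rule Max_ge[OF finite_benefits]) blast

end

theory Submission
  imports Defs
begin

text \<open>Run an arbitrary schedule against GREEDY and write \<open>M\<close>, \<open>G\<close> for the numbers of packets they
  have sent so far. GREEDY never falls behind on \<open>\<alpha>\<close>-packets, so \<open>M High \<le> G High\<close>. The surplus
  \<open>M Low + M High - G Low - G High\<close> turns out to be at most \<open>G High\<close> and at most \<open>G Low\<close>, and
  weighting these two bounds with \<open>\<alpha>\<close> and \<open>1\<close> gives the competitive ratio. The bound by \<open>G Low\<close> is
  the delicate one: the surplus grows only when GREEDY idles with empty queues, and the packets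
  its opponent then still stores are already paid for by \<open>1\<close>-packets that GREEDY has sent,
  because GREEDY rejects a \<open>1\<close>-packet only while holding \<open>B\<close> other ones.\<close>

text \<open>Here \<open>p\<close> and \<open>q\<close> are the queues of the opponent and of GREEDY. Pairs \<open>x \<le> y\<close>, \<open>x + p k \<le> y + q k\<close>
  stand for \<open>x + max 0 (p k - q k) \<le> y\<close>. In the last pair \<open>q Low\<close> counts twice, once for being
  stored by GREEDY and once as a \<open>1\<close>-packet that GREEDY is bound to send later.\<close>

definition ahead :: "nat \<Rightarrow> queues \<Rightarrow> queues \<Rightarrow> (kind \<Rightarrow> nat) \<Rightarrow> (kind \<Rightarrow> nat) \<Rightarrow> bool" where
  "ahead B p q M G \<longleftrightarrow>
     p Low \<le> B \<and> p High \<le> B \<and>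
     M High \<le> G High \<and>
     M High + p High \<le> G High + q High \<and>
     M Low \<le> G Low + G High \<and>
     M Low + p Low \<le> G Low + G High + q Low \<and>
     M Low + M High \<le> 2 * G Low + G High \<and>
     M Low + M High + p Low \<le> 2 * G Low + G High + 2 * q Low \<and>
     M Low + M High + p Low + p High \<le> 2 * G Low + G High + 2 * q Low + q High"

text \<open>When GREEDY rejects, its queue holds \<open>B\<close> packets, at least as many as the
  opponent's. For \<open>Low\<close>, the doubled \<open>q Low\<close> covers
  \<open>p Low + p High\<close>, as the capacities are equal.\<close>

lemma ahead_admission:
  assumes "admission B p ks p'" "ahead B p q M G"
  shows "ahead B p' (greedy_admit B q ks) M G"
  using assms
proof (induction arbitrary: q rule: admission.induct)
  case (reject p ks p' k)
  have "ahead B p (if q k < B then q(k := q k + 1) else q) M G"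
    using reject.prems by (cases k; cases "q k < B"; simp add: ahead_def)
  from reject.IH[OF this] show ?case by simp
next
  case (admit p k ks p')
  have "ahead B (p(k := p k + 1)) (if q k < B then q(k := q k + 1) else q) M G"
    using admit.prems admit.hyps(1) by (cases k; cases "q k < B"; simp add: ahead_def)
  from admit.IH[OF this] show ?case by simp
qed simp

definition record_sent :: "kind option \<Rightarrow> (kind \<Rightarrow> nat) \<Rightarrow> kind \<Rightarrow> nat" where
  "record_sent c N k = N k + (if c = Some k then 1 else 0)"

text \<open>If a left side grows alone, a queue of GREEDY is empty and the bound counting the sent
  packet as still stored takes over.\<close>

lemma ahead_transmission:
  assumes "transmission p c p'" "ahead B p q M G"
  shows "ahead B p' (remove (greedy_choice q) q)
    (record_sent c M) (record_sent (greedy_choice q) G)"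
  using assms(1)
proof cases
  case idle
  with assms(2) show ?thesis
    by (cases "q High"; cases "q Low";
        simp add: ahead_def greedy_choice_def remove_def record_sent_def)
next
  case (send k)
  from assms(2) send(3) show ?thesis unfolding send(1,2)
    by (cases k; cases "p k"; cases "q High"; cases "q Low")
       (simp_all add: ahead_def greedy_choice_def remove_def record_sent_def)
qed

definition sent :: "(nat \<Rightarrow> kind option) \<Rightarrow> nat \<Rightarrow> kind \<Rightarrow> nat" where
  "sent s t k = card {u. u < t \<and> s u = Some k}"

lemma sent_0: "sent s 0 = (\<lambda>_. 0)"
  by (simp add: sent_def fun_eq_iff)

lemma sent_Suc: "sent s (Suc t) = record_sent (s t) (sent s t)"
proof
  fix k
  have "{u. u < Suc t \<and> s u = Some k} =
      (if s t = Some k then insert t {u. u < t \<and> s u = Some k} else {u. u < t \<and> s u = Some k})"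
    by (auto simp: less_Suc_eq)
  then show "sent s (Suc t) k = record_sent (s t) (sent s t) k"
    by (simp add: sent_def record_sent_def)
qed

lemma eventually_sent:
  assumes "feasible B \<sigma> s"
  shows "\<forall>\<^sub>F t in sequentially. \<forall>k. sent s t k = card {u. s u = Some k}"
proof -
  obtain n where n: "\<And>u. s u \<noteq> None \<Longrightarrow> u < n"
    using finite_sent(1)[OF assms] unfolding finite_nat_set_iff_bounded by auto
  have "sent s t k = card {u. s u = Some k}" if "t \<ge> n" for t k
    unfolding sent_def using n that by (intro arg_cong[where f = card]) fastforce
  then show ?thesis by (auto simp: eventually_sequentially)
qed

lemma feasible_sent_bounds:
  assumes "feasible B \<sigma> s"
  defines "g \<equiv> greedy_schedule B \<sigma>"
  shows "sent s t High \<le> sent g t High"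
    and "sent s t Low \<le> sent g t Low + sent g t High"
    and "sent s t Low + sent s t High \<le> 2 * sent g t Low + sent g t High"
proof -
  obtain p p' where p0: "p 0 = (\<lambda>_. 0)"
    and adm: "\<And>t. admission B (p t) (slot \<sigma> t) (p' t)"
    and tra: "\<And>t. transmission (p' t) (s t) (p (Suc t))"
    using assms unfolding feasible_def by blast
  have "ahead B (p t) (greedy_queues B \<sigma> t) (sent s t) (sent g t)"
  proof (induction t)
    case 0
    show ?case by (simp add: ahead_def p0 sent_0)
  next
    case (Suc t)
    show ?case
      using ahead_transmission[OF tra ahead_admission[OF adm Suc]]
      by (simp add: sent_Suc g_def greedy_schedule_def Let_def)
  qed
  then show "sent s t High \<le> sent g t High"
    and "sent s t Low \<le> sent g t Low + sent g t High"
    and "sent s t Low + sent s t High \<le> 2 * sent g t Low + sent g t High"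
    by (auto simp: ahead_def)
qed

lemma competitive_arith:
  fixes \<alpha> l h l' h' :: real
  assumes "\<alpha> > 1" "h \<le> h'" "l \<le> l' + h'" "l + h \<le> 2 * l' + h'"
  shows "l + \<alpha> * h \<le> (\<alpha> + 2) / (\<alpha> + 1) * (l' + \<alpha> * h')"
proof -
  define m where "m = (l + h) - (l' + h')"
  \<comment> \<open>Each extra \<alpha>-packet of GREEDY is worth at least 1, so the opponent's lead
    is at most the surplus \<open>m\<close>.\<close>
  have "\<alpha> * h' - \<alpha> * h \<ge> h' - h"
    using mult_right_mono[of 1 \<alpha> "h' - h"] assms by (simp add: algebra_simps)
  then have "l + \<alpha> * h \<le> l' + \<alpha> * h' + m" by (simp add: m_def)
  then have "(\<alpha> + 1) * (l + \<alpha> * h) \<le> (\<alpha> + 1) * (l' + \<alpha> * h' + m)"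
    using assms by (intro mult_left_mono) auto
  moreover have "\<alpha> * m \<le> \<alpha> * h'" "m \<le> l'"
    using assms by (auto simp: m_def intro!: mult_left_mono)
  ultimately have "(\<alpha> + 1) * (l + \<alpha> * h) \<le> (\<alpha> + 2) * (l' + \<alpha> * h')"
    by (simp add: algebra_simps)
  with assms show ?thesis by (simp add: field_simps)
qed

theorem theorem3:
  fixes \<alpha> :: real and B :: nat
  assumes "\<alpha> > 1"
  shows "\<forall>\<sigma>. input_sequence \<sigma> \<longrightarrow> OPT \<alpha> B \<sigma> \<le> (\<alpha> + 2) / (\<alpha> + 1) * GREEDY \<alpha> B \<sigma>"
proof (intro allI impI)
  fix \<sigma>
  obtain s where s: "feasible B \<sigma> s" and opt: "OPT \<alpha> B \<sigma> = benefit \<alpha> s"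
    using OPT_attained by blast
  define g where "g = greedy_schedule B \<sigma>"
  have g: "feasible B \<sigma> g" by (simp add: g_def greedy_feasible)
  \<comment> \<open>Both schedules' counts are final from some time on.\<close>
  obtain t where t: "\<And>k. sent s t k = card {u. s u = Some k}"
      "\<And>k. sent g t k = card {u. g u = Some k}"
    using eventually_happens'[OF _ eventually_conj[OF eventually_sent[OF s] eventually_sent[OF g]]]
    by auto
  have "real (sent s t Low) + \<alpha> * real (sent s t High)
      \<le> (\<alpha> + 2) / (\<alpha> + 1) * (real (sent g t Low) + \<alpha> * real (sent g t High))"
    using feasible_sent_bounds[OF s, of t, folded g_def]
    by (intro competitive_arith[OF assms]) linarith+
  then show "OPT \<alpha> B \<sigma> \<le> (\<alpha> + 2) / (\<alpha> + 1) * GREEDY \<alpha> B \<sigma>"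
    by (simp add: opt GREEDY_def benefit_eq[OF s] benefit_eq[OF g] t flip: g_def)
qed

end
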